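(* Let $A\in\mathbb{C}^{n\times n}$ be nonsingular, $\boldsymbol{B}\in\mathbb{C}^{n\times s}$ and $m\ge 1$. The dimension of the extended block Krylov subspace $\mathcal{E}^{\square}_m(A,\boldsymbol{B})$ as a $\mathbb{C}$-vector space is $s^2m$ if and only if the inner product $\langle\!\langle\cdot,\cdot\rangle\!\rangle_{A,\boldsymbol{B}}$ is nondegenerate over $\mathbb{P}^s_{m-1}$. In this case, the mapping $$\mathcal{T}:\mathbb{L}^s_m\to\mathcal{E}^{\square}_m(A,\boldsymbol{B}),\qquad \mathcal{T}(R)=R(A)\circ\boldsymbol{B},$$ is an isometric linear isomorphism, with respect to $\langle\!\langle\cdot,\cdot\rangle\!\rangle_{A,\boldsymbol{B}}$ on $\mathbb{L}^s_m$ and the matrix-valued Euclidean inner product $\langle\!\langle\boldsymbol{X},\boldsymbol{Y}\rangle\!\rangle=\boldsymbol{X}^*\boldsymbol{Y}$ on $\mathcal{E}^{\square}_m(A,\boldsymbol{B})$.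
   Context: For $\boldsymbol{X}_1,\dots,\boldsymbol{X}_m\in\mathbb{C}^{n\times s}$, $\operatorname{blockspan}\{\boldsymbol{X}_1,\dots,\boldsymbol{X}_m\}=\{\sum_{k=1}^m\boldsymbol{X}_kC_k:\ C_k\in\mathbb{C}^{s\times s}\}$. The extended block Krylov subspace $\mathcal{E}^{\square}_m(A,\boldsymbol{B})$ is the blockspan of the first $m$ block vectors of the sequence $\boldsymbol{B},A\boldsymbol{B},A^{-1}\boldsymbol{B},A^2\boldsymbol{B},A^{-2}\boldsymbol{B},\dots$. $\mathbb{P}^s_{d}$ is the space of $s\times s$ matrix polynomials $\sum_{k=0}^{d}z^kC_k$, $C_k\in\mathbb{C}^{s\times s}$. $\mathbb{L}^s_m$ is the set of Laurent matrix polynomials generated (with $s\times s$ matrix coefficients) by the first $m$ terms of $I_s,zI_s,z^{-1}I_s,z^2I_s,z^{-2}I_s,\dots$; that is, $\mathbb{L}^s_{2\ell+1}=\{\sum_{k=-\ell}^{\ell}z^kC_k:C_k\in\mathbb{C}^{s\times s}\}$ and $\mathbb{L}^s_{2\ell+2}=\{\sum_{k=-\ell}^{\ell+1}z^kC_k:C_k\in\mathbb{C}^{s\times s}\}$. For a (Laurent) matrix polynomial $R(z)=\sum_k z^kC_k$, $R(A)\circ\boldsymbol{B}=\sum_kA^k\boldsymbol{B}C_k\in\mathbb{C}^{n\times s}$, and $\langle\!\langle R,S\rangle\!\rangle_{A,\boldsymbol{B}}=(R(A)\circ\boldsymbol{B})^*\,(S(A)\circ\boldsymbol{B})\in\mathbb{C}^{s\times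 s}$. This is nondegenerate over $\mathbb{P}^s_{m-1}$ if $\langle\!\langle P,P\rangle\!\rangle_{A,\boldsymbol{B}}\neq 0$ for every $P\in\mathbb{P}^s_{m-1}$, $P\not\equiv 0$. Isometric means $\langle\!\langle R,S\rangle\!\rangle_{A,\boldsymbol{B}}=\mathcal{T}(R)^*\mathcal{T}(S)$ for all $R,S\in\mathbb{L}^s_m$. *)

theory Defs
  imports "HOL-Analysis.Analysis" "HOL-Library.Poly_Mapping"
begin

section \<open>Complex matrices\<close>

text \<open>An \<open>n \<times> s\<close> matrix has type \<open>complex^'s^'n\<close>. On this type the library only provides the
  real vector space structure and (as \<open>*\<close>) the entrywise product, hence the definitions of the
  complex scaling and of matrix powers below.\<close>

definition cmat_scale :: "complex \<Rightarrow> complex^'s^'n \<Rightarrow> complex^'s^'n" where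
  "cmat_scale c X = map_matrix (\<lambda>x. c * x) X"

lemma cmat_scale_nth [simp]: "cmat_scale c X $ i $ j = c * X $ i $ j"
  by (simp add: cmat_scale_def map_matrix_def)

global_interpretation cmat: vector_space "cmat_scale :: complex \<Rightarrow> complex^'s^'n \<Rightarrow> complex^'s^'n"
  by unfold_locales (auto simp: vec_eq_iff algebra_simps)

lemma matrix_mul_cmat_scale: "X ** cmat_scale c C = cmat_scale c (X ** C)"
  by (simp add: vec_eq_iff matrix_matrix_mult_def sum_distrib_left mult_ac)

definition conj_transpose :: "complex^'s^'n \<Rightarrow> complex^'n^'s" where
  "conj_transpose X = map_matrix cnj (transpose X)"

text \<open>The matrix-valued Euclidean inner product \<open>X\<^sup>* Y\<close>.\<close>

definition mat_inner :: "complex^'s^'n \<Rightarrow> complex^'s^'n \<Rightarrow> complex^'s^'s" where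
  "mat_inner X Y = conj_transpose X ** Y"

text \<open>For negative \<open>k\<close> this is meaningful only for invertible \<open>A\<close>.\<close>

definition mat_powi :: "complex^'n^'n \<Rightarrow> int \<Rightarrow> complex^'n^'n" where
  "mat_powi A k =
     (if 0 \<le> k then ((\<lambda>M. A ** M) ^^ nat k) (mat 1)
      else ((\<lambda>M. matrix_inv A ** M) ^^ nat (- k)) (mat 1))"


section \<open>Extended block Krylov subspaces\<close>

definition blockspan :: "nat \<Rightarrow> (nat \<Rightarrow> complex^'s^'n) \<Rightarrow> (complex^'s^'n) set" where
  "blockspan m X = {\<Sum>k<m. X k ** C k | C :: nat \<Rightarrow> complex^'s^'s. True}"

text \<open>The sequence of exponents \<open>0, 1, -1, 2, -2, \<dots>\<close>.\<close>

definition ext_exponent :: "nat \<Rightarrow> int" where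
  "ext_exponent j = (if even j then - int (j div 2) else int (j div 2) + 1)"

definition ext_block_krylov :: "complex^'n^'n \<Rightarrow> complex^'s^'n \<Rightarrow> nat \<Rightarrow> (complex^'s^'n) set" where
  "ext_block_krylov A B m = blockspan m (\<lambda>j. mat_powi A (ext_exponent j) ** B)"

lemma subspace_blockspan: "cmat.subspace (blockspan m X)"
proof (rule cmat.subspaceI)
  show "0 \<in> blockspan m X"
    unfolding blockspan_def by (auto intro!: exI[of _ "\<lambda>_. 0"] simp: vec_eq_iff matrix_matrix_mult_def)
next
  fix x y assume "x \<in> blockspan m X" "y \<in> blockspan m X"
  then obtain C D where "x = (\<Sum>k<m. X k ** C k)" "y = (\<Sum>k<m. X k ** D k)"
    unfolding blockspan_def by auto
  then have "x + y = (\<Sum>k<m. X k ** (C k + D k))"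
    by (simp add: matrix_add_ldistrib sum.distrib)
  then show "x + y \<in> blockspan m X"
    unfolding blockspan_def by (auto intro: exI[of _ "\<lambda>k. C k + D k"])
next
  fix c x assume "x \<in> blockspan m X"
  then obtain C where "x = (\<Sum>k<m. X k ** C k)"
    unfolding blockspan_def by auto
  then have "cmat_scale c x = (\<Sum>k<m. X k ** cmat_scale c (C k))"
    by (simp add: matrix_mul_cmat_scale cmat.scale_sum_right)
  then show "cmat_scale c x \<in> blockspan m X"
    unfolding blockspan_def by (auto intro: exI[of _ "\<lambda>k. cmat_scale c (C k)"])
qed


section \<open>Laurent matrix polynomials\<close>

text \<open>A Laurent matrix polynomial is given by its finitely supported coefficient family;
  \<open>Poly_Mapping.single k C\<close> is \<open>z\<^sup>k C\<close>. Matrix polynomials are those without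
  negative exponents. The multiplication of \<open>poly_mapping\<close> is not used (it would be built from the
  entrywise product of matrices).\<close>

type_synonym 's laurent_mpoly = "int \<Rightarrow>\<^sub>0 (complex^'s^'s)"

definition laurent_scale :: "complex \<Rightarrow> 's::finite laurent_mpoly \<Rightarrow> 's laurent_mpoly" where
  "laurent_scale c R = Poly_Mapping.map (cmat_scale c) R"

lemma lookup_laurent_scale [simp]:
  "Poly_Mapping.lookup (laurent_scale c R) k = cmat_scale c (Poly_Mapping.lookup R k)"
  by (simp add: laurent_scale_def Poly_Mapping.map.rep_eq when_def)

global_interpretation laurent: vector_space "laurent_scale :: complex \<Rightarrow> 's::finite laurent_mpoly \<Rightarrow> _"
  by unfold_locales
    (auto intro!: poly_mapping_eqI simp: lookup_add cmat.scale_left_distrib cmat.scale_right_distrib)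

text \<open>\<open>mpoly_space d\<close> consists of the \<open>\<Sum>k=0..d. z\<^sup>k C\<^sub>k\<close>; \<open>laurent_space m\<close> is generated, with
  matrix coefficients, by the first \<open>m\<close> of \<open>I, z I, z\<^sup>-\<^sup>1 I, z\<^sup>2 I, z\<^sup>-\<^sup>2 I, \<dots>\<close>.\<close>

definition mpoly_space :: "nat \<Rightarrow> 's::finite laurent_mpoly set" where
  "mpoly_space d = {\<Sum>k\<le>d. Poly_Mapping.single (int k) (C k) | C. True}"

definition laurent_space :: "nat \<Rightarrow> 's::finite laurent_mpoly set" where
  "laurent_space m = {\<Sum>j<m. Poly_Mapping.single (ext_exponent j) (C j) | C. True}"

lemma bij_betw_ext_exponent:
  "bij_betw ext_exponent {..<m} {- int ((m - 1) div 2)..int (m div 2)}" if "m > 0"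
proof (rule bij_betw_byWitness[where f' = "\<lambda>k. if k \<le> 0 then 2 * nat (- k) else 2 * nat k - 1"])
qed (use that in \<open>auto simp: ext_exponent_def elim!: evenE oddE split: if_splits\<close>)

lemma laurent_space_eq:
  assumes "m > 0"
  shows "(laurent_space m :: 's::finite laurent_mpoly set) =
    {\<Sum>k = - int ((m - 1) div 2)..int (m div 2). Poly_Mapping.single k (C k) | C. True}"
    (is "_ = ?R")
proof (intro equalityI subsetI)
  note bij = bij_betw_ext_exponent[OF assms]
  fix x :: "'s laurent_mpoly"
  {
    assume "x \<in> laurent_space m"
    then obtain C where x: "x = (\<Sum>j<m. Poly_Mapping.single (ext_exponent j) (C j))"
      unfolding laurent_space_def by auto
    have "x = (\<Sum>k = - int ((m - 1) div 2)..int (m div 2).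
        Poly_Mapping.single k (C (the_inv_into {..<m} ext_exponent k)))"
      unfolding x sum.reindex_bij_betw[OF bij, symmetric]
      by (rule sum.cong)
        (use bij in \<open>auto simp: bij_betw_def the_inv_into_f_f\<close>)
    then show "x \<in> ?R"
      by (intro CollectI exI[of _ "\<lambda>k. C (the_inv_into {..<m} ext_exponent k)"] conjI TrueI)
  next
    assume "x \<in> ?R"
    then obtain C where x: "x = (\<Sum>k = - int ((m - 1) div 2)..int (m div 2). Poly_Mapping.single k (C k))"
      by auto
    have "x = (\<Sum>j<m. Poly_Mapping.single (ext_exponent j) (C (ext_exponent j)))"
      unfolding x sum.reindex_bij_betw[OF bij, symmetric] ..
    then show "x \<in> laurent_space m"
      unfolding laurent_space_def by (auto intro!: exI[of _ "\<lambda>j. C (ext_exponent j)"])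
  }
qed

lemma laurent_space_odd:
  "laurent_space (2 * l + 1) = {\<Sum>k = - int l..int l. Poly_Mapping.single k (C k) | C. True}"
  by (subst laurent_space_eq) auto

lemma laurent_space_even:
  "laurent_space (2 * l + 2) = {\<Sum>k = - int l..int l + 1. Poly_Mapping.single k (C k) | C. True}"
  by (subst laurent_space_eq) (auto simp: add.commute)

lemma subspace_laurent_space: "laurent.subspace (laurent_space m :: 's::finite laurent_mpoly set)"
proof (rule laurent.subspaceI)
  show "0 \<in> (laurent_space m :: 's laurent_mpoly set)"
    unfolding laurent_space_def by (auto intro!: exI[of _ "\<lambda>_. 0"])
next
  fix x y :: "'s laurent_mpoly" assume "x \<in> laurent_space m" "y \<in> laurent_space m"
  then obtain C D where "x = (\<Sum>j<m. Poly_Mapping.single (ext_exponent j) (C j))"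
    "y = (\<Sum>j<m. Poly_Mapping.single (ext_exponent j) (D j))"
    unfolding laurent_space_def by auto
  then have "x + y = (\<Sum>j<m. Poly_Mapping.single (ext_exponent j) (C j + D j))"
    by (simp add: single_add sum.distrib)
  then show "x + y \<in> laurent_space m"
    unfolding laurent_space_def by (auto intro: exI[of _ "\<lambda>k. C k + D k"])
next
  fix c and x :: "'s laurent_mpoly" assume "x \<in> laurent_space m"
  then obtain C where x: "x = (\<Sum>j<m. Poly_Mapping.single (ext_exponent j) (C j))"
    unfolding laurent_space_def by auto
  have "laurent_scale c (Poly_Mapping.single k D) = Poly_Mapping.single k (cmat_scale c D)" for k and D :: "complex^'s^'s"
    by (rule poly_mapping_eqI) (simp add: lookup_single when_def)
  then have "laurent_scale c x = (\<Sum>j<m. Poly_Mapping.single (ext_exponent j) (cmat_scale c (C j)))"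
    unfolding x by (simp add: laurent.scale_sum_right)
  then show "laurent_scale c x \<in> laurent_space m"
    unfolding laurent_space_def by (auto intro: exI[of _ "\<lambda>k. cmat_scale c (C k)"])
qed

text \<open>\<open>laurent_apply A B R\<close> is \<open>R(A) \<circ> B = \<Sum>k. A\<^sup>k B C\<^sub>k\<close> for \<open>R = \<Sum>k. z\<^sup>k C\<^sub>k\<close>.\<close>

definition laurent_apply ::
    "complex^'n^'n \<Rightarrow> complex^'s^'n \<Rightarrow> 's::finite laurent_mpoly \<Rightarrow> complex^'s^'n" where
  "laurent_apply A B R = (\<Sum>k\<in>Poly_Mapping.keys R. mat_powi A k ** B ** Poly_Mapping.lookup R k)"

definition laurent_inner ::
    "complex^'n^'n \<Rightarrow> complex^'s^'n \<Rightarrow> 's::finite laurent_mpoly \<Rightarrow> 's laurent_mpoly \<Rightarrow> complex^'s^'s" where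
  "laurent_inner A B R S = conj_transpose (laurent_apply A B R) ** laurent_apply A B S"

definition nondegenerate_over ::
    "complex^'n^'n \<Rightarrow> complex^'s^'n \<Rightarrow> 's::finite laurent_mpoly set \<Rightarrow> bool" where
  "nondegenerate_over A B V \<longleftrightarrow> (\<forall>P\<in>V. P \<noteq> 0 \<longrightarrow> laurent_inner A B P P \<noteq> 0)"


section \<open>Isometric linear isomorphisms\<close>

definition linear_iso_on ::
    "'s::finite laurent_mpoly set \<Rightarrow> (complex^'s^'n) set \<Rightarrow> ('s laurent_mpoly \<Rightarrow> complex^'s^'n) \<Rightarrow> bool" where
  "linear_iso_on V W f \<longleftrightarrow>
     (\<forall>R\<in>V. \<forall>S\<in>V. f (R + S) = f R + f S) \<and>
     (\<forall>c. \<forall>R\<in>V. f (laurent_scale c R) = cmat_scale c (f R)) \<and>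
     bij_betw f V W"

definition isometric_on ::
    "('s::finite laurent_mpoly \<Rightarrow> 's laurent_mpoly \<Rightarrow> complex^'s^'s) \<Rightarrow> 's laurent_mpoly set \<Rightarrow>
     ('s laurent_mpoly \<Rightarrow> complex^'s^'n) \<Rightarrow> bool" where
  "isometric_on ip V f \<longleftrightarrow> (\<forall>R\<in>V. \<forall>S\<in>V. ip R S = mat_inner (f R) (f S))"

end

theory Submission
  imports Defs
begin

text \<open>Multiplication by \<open>z\<^sup>l\<close> carries a Laurent space with lowest exponent \<open>-l\<close> onto the
  matrix polynomials of the same length, and on the values \<open>R(A) \<circ> B\<close> it acts as the invertible
  matrix \<open>A\<^sup>l\<close>. So the evaluation map has trivial kernel on one space iff it does on the other.
  Since \<open>X\<^sup>* X = 0\<close> only for \<open>X = 0\<close>, nondegeneracy says precisely that the kernel on the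
  polynomials is trivial; since the Laurent space has dimension \<open>s\<^sup>2 m\<close> and is mapped onto the
  Krylov space, the dimension condition says precisely that the kernel on the Laurent space is
  trivial.\<close>

section \<open>Dimensions of images of linear maps\<close>

lemma (in vector_space) independent_if_card_le_dim_span:
  assumes "finite S" and "card S \<le> dim (span S)"
  shows "independent S"
proof -
  obtain D where D: "D \<subseteq> S" "independent D" "S \<subseteq> span D"
    using maximal_independent_subset[of S] by blast
  \<comment> \<open>A maximal independent subset still spans \<open>S\<close>, so it has
    \<open>dim S\<close> elements; the cardinality bound leaves nothing of \<open>S\<close> outside
    it.\<close>
  then have "card D = dim S"
    by (intro basis_card_eq_dim)
  with assms D(1) have "D = S"
    by (intro card_seteq) simp_all
  with D(2) show ?thesis by simp
qed

lemma (in vector_space_pair) dim_image_span_eq_card_iff: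
  assumes f: "Vector_Spaces.linear s1 s2 f" and S: "vs1.independent S" "finite S"
  shows "vs2.dim (f ` vs1.span S) = card S \<longleftrightarrow> inj_on f (vs1.span S)"
proof
  assume dim: "vs2.dim (f ` vs1.span S) = card S"
  have img: "f ` vs1.span S = vs2.span (f ` S)"
    using linear_span_image[OF f] by simp
  have le: "card (f ` S) \<le> card S"
    using S(2) by (rule card_image_le)
  have "vs2.dim (vs2.span (f ` S)) \<le> card (f ` S)"
    using S(2) by (simp add: vs2.dim_le_card')
  then have "card (f ` S) = card S"
    using le dim img by simp
  then have "inj_on f S"
    using S(2) by (simp add: eq_card_imp_inj_on)
  moreover have "vs2.independent (f ` S)"
    using S(2) le dim img by (intro vs2.independent_if_card_le_dim_span) simp_all
  ultimately show "inj_on f (vs1.span S)"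
    using linear_inj_on_span_iff_independent_image[OF f] by blast
next
  assume inj: "inj_on f (vs1.span S)"
  then have "vs2.independent (f ` S)"
    using linear_independent_injective_image[OF f S(1)] by blast
  then have "vs2.dim (vs2.span (f ` S)) = card (f ` S)"
    by (rule vs2.dim_span_eq_card_independent)
  also have "card (f ` S) = card S"
    using inj_on_subset[OF inj vs1.span_superset] by (rule card_image)
  finally show "vs2.dim (f ` vs1.span S) = card S"
    using linear_span_image[OF f] by simp
qed

section \<open>Complex matrices and integer powers\<close>

lemma conj_transpose_mult_self_eq_0_iff:
  fixes X :: "complex^'s^'n"
  shows "conj_transpose X ** X = 0 \<longleftrightarrow> X = 0"
proof
  assume *: "conj_transpose X ** X = 0"
  have "X $ i $ j = 0" for i j
  proof -
    \<comment> \<open>Diagonal entry \<open>j\<close> of the product is the squared Euclidean norm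
      of column \<open>j\<close> of \<open>X\<close>.\<close>
    have "(\<Sum>k\<in>UNIV. cnj (X $ k $ j) * X $ k $ j) = 0"
      using arg_cong[OF *, of "\<lambda>M. M $ j $ j"]
      by (simp add: matrix_matrix_mult_def conj_transpose_def map_matrix_def transpose_def)
    also have "(\<lambda>k. cnj (X $ k $ j) * X $ k $ j) = (\<lambda>k. of_real ((cmod (X $ k $ j))\<^sup>2))"
      by (simp add: complex_norm_square mult.commute fun_eq_iff del: of_real_power)
    finally have "complex_of_real (\<Sum>k\<in>UNIV. (cmod (X $ k $ j))\<^sup>2) = 0"
      by simp
    then have "(\<Sum>k\<in>UNIV. (cmod (X $ k $ j))\<^sup>2) = 0"
      by (simp only: of_real_eq_0_iff)
    then show ?thesis
      by (simp add: sum_nonneg_eq_0_iff)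
  qed
  then show "X = 0" by (simp add: vec_eq_iff)
qed (simp add: vec_eq_iff matrix_matrix_mult_def)

lemma matrix_mult_zero_right [simp]: "X ** (0 :: complex^'s^'n) = 0"
  by (simp add: vec_eq_iff matrix_matrix_mult_def)

lemma matrix_mult_sum_right: "X ** (\<Sum>k\<in>K. f k) = (\<Sum>k\<in>K. X ** (f k :: complex^'s^'n))"
  by (induction K rule: infinite_finite_induct) (simp_all add: matrix_add_ldistrib)

lemma invertible_mult_left_eq_0_iff:
  fixes A :: "complex^'n^'n" and X :: "complex^'s^'n"
  assumes "invertible A"
  shows "A ** X = 0 \<longleftrightarrow> X = 0"
proof
  obtain A' where "A' ** A = mat 1"
    using assms by (auto simp: invertible_def)
  moreover assume "A ** X = 0"
  then have "A' ** A ** X = 0"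
    by (simp flip: matrix_mul_assoc)
  ultimately show "X = 0" by simp
qed simp

text \<open>For nonnegative exponents this is one more iteration; for negative ones the new factor
  \<open>A\<close> cancels the outermost \<open>matrix_inv A\<close>.\<close>

lemma mult_mat_powi:
  fixes A :: "complex^'n^'n"
  assumes "invertible A"
  shows "A ** mat_powi A k = mat_powi A (k + 1)"
proof (cases "0 \<le> k")
  case True
  then show ?thesis by (simp add: mat_powi_def nat_add_distrib)
next
  case False
  then obtain n where n: "k = - int (Suc n)"
    by (metis int_cases not_le of_nat_0_le_iff)
  have "A ** matrix_inv A = mat 1"
    using assms unfolding matrix_inv_def invertible_def by (rule someI2_ex) simp
  then have cancel: "A ** (matrix_inv A ** M) = M" for M :: "complex^'n^'n"
    by (simp add: matrix_mul_assoc)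
  \<comment> \<open>The case \<open>n = 0\<close> is the passage from exponent -1 to 0, where
    \<open>mat_powi\<close> changes branch.\<close>
  show ?thesis
    unfolding n by (cases n) (simp_all add: mat_powi_def cancel \<open>A ** matrix_inv A = mat 1\<close> nat_add_distrib)
qed

section \<open>Linearity of the evaluation map\<close>

lemma laurent_apply_superset:
  assumes "finite K" and "Poly_Mapping.keys R \<subseteq> K"
  shows "laurent_apply A B R = (\<Sum>k\<in>K. mat_powi A k ** B ** Poly_Mapping.lookup R k)"
  unfolding laurent_apply_def
  by (rule sum.mono_neutral_left) (use assms in \<open>auto simp: in_keys_iff\<close>)

lemma linear_laurent_apply:
  fixes A :: "complex^'n^'n" and B :: "complex^'s^'n"
  shows "Vector_Spaces.linear laurent_scale cmat_scale (laurent_apply A B)"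
proof (intro module_hom.intro[THEN Vector_Spaces.linear.intro[rotated 2]] module_hom_axioms.intro)
  fix R S :: "'s laurent_mpoly" and c
  \<comment> \<open>The supports of \<open>R\<close>, \<open>S\<close> and \<open>R + S\<close> may
    all differ, by cancellation too. Over the common index set \<open>?K\<close> the three sums
    compare term by term.\<close>
  let ?K = "Poly_Mapping.keys R \<union> Poly_Mapping.keys S"
  have "Poly_Mapping.keys (R + S) \<subseteq> ?K"
    by (rule Poly_Mapping.keys_add)
  then show "laurent_apply A B (R + S) = laurent_apply A B R + laurent_apply A B S"
    by (simp add: laurent_apply_superset[of ?K] lookup_add matrix_add_ldistrib sum.distrib)
  have "Poly_Mapping.keys (laurent_scale c R) \<subseteq> Poly_Mapping.keys R"
    by (auto simp: in_keys_iff)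
  then show "laurent_apply A B (laurent_scale c R) = cmat_scale c (laurent_apply A B R)"
    by (simp add: laurent_apply_superset[of "Poly_Mapping.keys R"] matrix_mul_cmat_scale
        cmat.scale_sum_right)
qed unfold_locales

global_interpretation laurent_cmat: vector_space_pair
  "laurent_scale :: complex \<Rightarrow> 's::finite laurent_mpoly \<Rightarrow> _"
  "cmat_scale :: complex \<Rightarrow> complex^'s^'n \<Rightarrow> _" ..

section \<open>Multiplication by \<open>z\<^sup>l\<close>, encoded as a shift of exponents\<close>

definition laurent_shift :: "int \<Rightarrow> 's::finite laurent_mpoly \<Rightarrow> 's laurent_mpoly" where
  "laurent_shift l R = Poly_Mapping.map_key (\<lambda>k. k - l) R"

lemma lookup_laurent_shift [simp]:
  "Poly_Mapping.lookup (laurent_shift l R) k = Poly_Mapping.lookup R (k - l)"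
  by (simp add: laurent_shift_def map_key.rep_eq)

lemma keys_laurent_shift: "Poly_Mapping.keys (laurent_shift l R) = (+) l ` Poly_Mapping.keys R"
proof (intro equalityI subsetI)
  fix k assume "k \<in> Poly_Mapping.keys (laurent_shift l R)"
  then show "k \<in> (+) l ` Poly_Mapping.keys R"
    by (intro image_eqI[of _ _ "k - l"]) (auto simp: in_keys_iff)
qed (auto simp: in_keys_iff)

lemma laurent_shift_0 [simp]: "laurent_shift 0 R = R"
  by (rule poly_mapping_eqI) simp

lemma laurent_shift_add: "laurent_shift a (laurent_shift b R) = laurent_shift (a + b) R"
  by (rule poly_mapping_eqI) (simp add: algebra_simps)

lemma laurent_shift_eq_0_iff [simp]: "laurent_shift l R = 0 \<longleftrightarrow> R = 0"
  by (simp flip: Poly_Mapping.keys_eq_empty add: keys_laurent_shift)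

text \<open>Coefficients act from the right and powers of \<open>A\<close> from the left, so raising
  every exponent by one pulls a single factor \<open>A\<close> out of the sum.\<close>

lemma laurent_apply_shift_1:
  assumes "invertible A"
  shows "laurent_apply A B (laurent_shift 1 R) = A ** laurent_apply A B R"
  unfolding laurent_apply_def keys_laurent_shift
  by (simp add: sum.reindex matrix_mult_sum_right matrix_mul_assoc mult_mat_powi[OF assms] add.commute)

text \<open>Induction on \<open>l\<close> peels off unit shifts, each of which multiplies the value
  by the invertible \<open>A\<close>.\<close>

lemma laurent_apply_shift_eq_0_iff:
  assumes "invertible A"
  shows "laurent_apply A B (laurent_shift (int l) R) = 0 \<longleftrightarrow> laurent_apply A B R = 0"
proof (induction l)
  case (Suc l)
  have "laurent_shift (int (Suc l)) R = laurent_shift 1 (laurent_shift (int l) R)"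
    by (simp add: laurent_shift_add)
  with Suc show ?case
    by (simp add: laurent_apply_shift_1[OF assms] invertible_mult_left_eq_0_iff[OF assms])
qed simp

section \<open>Laurent and polynomial spaces as support conditions\<close>

lemma poly_mapping_sum_single:
  assumes "finite K" and "Poly_Mapping.keys R \<subseteq> K"
  shows "R = (\<Sum>k\<in>K. Poly_Mapping.single k (Poly_Mapping.lookup R k))"
  by (rule poly_mapping_eqI)
    (use assms in \<open>auto simp: lookup_sum lookup_single when_def in_keys_iff sum.delta\<close>)

text \<open>Replaces the existential over coefficients by a bound on the support, so that shifting a
  space becomes translating an interval. Injectivity of \<open>e\<close> lets \<open>C i\<close> be
  read off as the coefficient at \<open>e i\<close>.\<close>

lemma sum_single_collect_eq:
  fixes e :: "'i \<Rightarrow> 'k"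
  assumes "inj_on e I" and "finite I"
  shows "{\<Sum>i\<in>I. Poly_Mapping.single (e i) (C i) | C. True} = {R. Poly_Mapping.keys R \<subseteq> e ` I}"
    (is "?L = ?R")
proof (intro equalityI subsetI)
  fix R assume "R \<in> ?L"
  then obtain C where "R = (\<Sum>i\<in>I. Poly_Mapping.single (e i) (C i))" by blast
  then have "Poly_Mapping.lookup R k = 0" if "k \<notin> e ` I" for k
    using that by (auto simp: lookup_sum lookup_single when_def intro!: sum.neutral)
  then show "R \<in> ?R" by (auto simp: in_keys_iff)
next
  fix R assume "R \<in> ?R"
  then have "R = (\<Sum>i\<in>I. Poly_Mapping.single (e i) (Poly_Mapping.lookup R (e i)))"
    using poly_mapping_sum_single[of "e ` I" R] assms by (simp add: sum.reindex)
  then show "R \<in> ?L"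
    by (intro CollectI exI[of _ "\<lambda>i. Poly_Mapping.lookup R (e i)"] conjI TrueI)
qed

lemma laurent_space_eq_keys:
  assumes "m \<ge> 1"
  shows "laurent_space m = {R. Poly_Mapping.keys R \<subseteq> {- int ((m - 1) div 2)..int (m div 2)}}"
  unfolding laurent_space_def
  using sum_single_collect_eq[of ext_exponent "{..<m}"] bij_betw_ext_exponent[of m] assms
  by (simp add: bij_betw_def)

lemma mpoly_space_eq_keys: "mpoly_space d = {R. Poly_Mapping.keys R \<subseteq> {0..int d}}"
proof -
  have "int ` {..d} = {0..int d}"
    using image_int_atLeastAtMost[of 0 d] by (simp add: atMost_atLeast0)
  then show ?thesis
    unfolding mpoly_space_def using sum_single_collect_eq[of int "{..d}"] by simp
qed

section \<open>A complex basis: \<open>z\<^sup>k\<close> times the matrix unit with entry 1 at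
  \<open>(p, q)\<close>\<close>

definition laurent_unit :: "int \<times> 's::finite \<times> 's \<Rightarrow> 's laurent_mpoly" where
  "laurent_unit = (\<lambda>(k, p, q). Poly_Mapping.single k (\<chi> i j. if i = p \<and> j = q then 1 else 0))"

lemma lookup_laurent_unit:
  "Poly_Mapping.lookup (laurent_unit x) k $ p $ q = (if x = (k, p, q) then 1 else 0)"
  by (cases x) (auto simp: laurent_unit_def lookup_single when_def)

lemma inj_laurent_unit: "inj laurent_unit"
proof (rule injI)
  fix x y :: "int \<times> 's::finite \<times> 's" assume eq: "laurent_unit x = laurent_unit y"
  obtain k p q where x: "x = (k, p, q)" by (cases x)
  then have "Poly_Mapping.lookup (laurent_unit y) k $ p $ q = 1"
    unfolding eq[symmetric] by (simp only: lookup_laurent_unit if_True simp_thms)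
  then show "x = y"
    unfolding lookup_laurent_unit x by (simp split: if_splits)
qed

text \<open>The scalars of a combination are the entries of its coefficient matrices. This one
  computation yields both independence and spanning.\<close>

lemma laurent_combination_lookup:
  assumes "finite K" and "k \<in> K"
  shows "Poly_Mapping.lookup (\<Sum>x\<in>K \<times> UNIV. laurent_scale (u x) (laurent_unit x)) k $ p $ q = u (k, p, q)"
proof -
  have "Poly_Mapping.lookup (\<Sum>x\<in>K \<times> UNIV. laurent_scale (u x) (laurent_unit x)) k $ p $ q
      = (\<Sum>x\<in>K \<times> UNIV. if x = (k, p, q) then u x else 0)"
    by (simp add: lookup_sum sum_component lookup_laurent_unit if_distrib cong: if_cong)
  also have "\<dots> = u (k, p, q)"
    using assms by (simp add: sum.delta)
  finally show ?thesis .
qed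

lemma independent_laurent_unit:
  assumes "finite K"
  shows "laurent.independent (laurent_unit ` (K \<times> (UNIV :: ('s::finite \<times> 's) set)))"
proof (rule laurent.independent_if_scalars_zero)
  fix u and R :: "'s laurent_mpoly"
  assume "(\<Sum>R\<in>laurent_unit ` (K \<times> (UNIV :: ('s \<times> 's) set)). laurent_scale (u R) R) = 0"
    and R: "R \<in> laurent_unit ` (K \<times> UNIV)"
  then have *: "(\<Sum>x\<in>K \<times> UNIV. laurent_scale (u (laurent_unit x)) (laurent_unit x)) = 0"
    by (simp add: sum.reindex inj_on_subset[OF inj_laurent_unit])
  from R obtain k p q where "R = laurent_unit (k, p, q)" "k \<in> K" by auto
  with laurent_combination_lookup[OF assms, of k "\<lambda>x. u (laurent_unit x)" p q]
  show "u R = 0" by (simp add: *)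
qed (use assms in simp)

lemma span_laurent_unit:
  assumes "finite K"
  shows "laurent.span (laurent_unit ` (K \<times> UNIV)) = {R :: 's::finite laurent_mpoly. Poly_Mapping.keys R \<subseteq> K}"
proof (rule laurent.span_unique)
  show "laurent_unit ` (K \<times> UNIV) \<subseteq> {R :: 's laurent_mpoly. Poly_Mapping.keys R \<subseteq> K}"
    by (auto simp: laurent_unit_def split: if_splits)
  show "laurent.subspace {R :: 's laurent_mpoly. Poly_Mapping.keys R \<subseteq> K}"
  proof -
    have "Poly_Mapping.keys R \<subseteq> K \<longleftrightarrow> (\<forall>k. k \<notin> K \<longrightarrow> Poly_Mapping.lookup R k = 0)"
      for R :: "'s laurent_mpoly"
      by (auto simp: in_keys_iff)
    then show ?thesis
      by (intro laurent.subspaceI) (simp_all add: lookup_add)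
  qed
next
  fix T :: "'s laurent_mpoly set" assume T: "laurent_unit ` (K \<times> UNIV) \<subseteq> T" "laurent.subspace T"
  show "{R :: 's laurent_mpoly. Poly_Mapping.keys R \<subseteq> K} \<subseteq> T"
  proof clarify
    fix R :: "'s laurent_mpoly" assume R: "Poly_Mapping.keys R \<subseteq> K"
    \<comment> \<open>The coordinates of \<open>R\<close> are its coefficient entries. At exponents
      outside \<open>K\<close> both sides vanish, on the left by the support bound.\<close>
    let ?u = "\<lambda>(k, p, q). Poly_Mapping.lookup R k $ p $ q"
    let ?S = "\<Sum>x\<in>K \<times> UNIV. laurent_scale (?u x) (laurent_unit x)"
    have "R = ?S"
    proof (rule poly_mapping_eqI)
      fix k
      show "Poly_Mapping.lookup R k = Poly_Mapping.lookup ?S k"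
      proof (cases "k \<in> K")
        case True
        then show ?thesis
          using laurent_combination_lookup[OF assms True, of ?u] by (simp add: vec_eq_iff)
      next
        case False
        then have "Poly_Mapping.lookup R k = 0"
          using R by (auto simp: in_keys_iff)
        moreover have "Poly_Mapping.lookup ?S k = 0"
          unfolding lookup_sum using False
          by (intro sum.neutral) (auto simp: vec_eq_iff lookup_laurent_unit)
        ultimately show ?thesis by simp
      qed
    qed
    also have "?S \<in> T"
      using T by (intro laurent.subspace_sum laurent.subspace_scale) auto
    finally show "R \<in> T" .
  qed
qed

section \<open>Injectivity of evaluation: dimension and nondegeneracy\<close>

lemma dim_image_laurent_apply_iff:
  fixes B :: "complex^'s^'n"
  assumes "finite K"
  shows "cmat.dim (laurent_apply A B ` {R. Poly_Mapping.keys R \<subseteq> K}) = CARD('s)^2 * card K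
    \<longleftrightarrow> inj_on (laurent_apply A B) {R. Poly_Mapping.keys R \<subseteq> K}"
proof -
  \<comment> \<open>Each exponent in \<open>K\<close> contributes \<open>CARD('s)^2\<close> basis
    elements, one per matrix position.\<close>
  have "card (laurent_unit ` (K \<times> (UNIV :: ('s \<times> 's) set))) = card (K \<times> (UNIV :: ('s \<times> 's) set))"
    by (rule card_image[OF inj_on_subset[OF inj_laurent_unit]]) simp
  also have "\<dots> = CARD('s)^2 * card K"
    by (simp add: card_cartesian_product power2_eq_square)
  finally show ?thesis
    using laurent_cmat.dim_image_span_eq_card_iff[OF linear_laurent_apply
        independent_laurent_unit[OF assms], of A B] assms
    by (simp add: span_laurent_unit)
qed

text \<open>Both spaces run through the same exponents \<open>ext_exponent j\<close>, and evaluation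
  is linear and sends \<open>z\<^sup>k C\<close> to \<open>A\<^sup>k B C\<close>. This is the
  surjectivity half of the isomorphism.\<close>

lemma ext_block_krylov_eq_image: "ext_block_krylov A B m = laurent_apply A B ` laurent_space m"
proof -
  have single: "laurent_apply A B (Poly_Mapping.single k C) = mat_powi A k ** B ** C" for k C
    by (simp add: laurent_apply_superset[of "{k}"])
  have "laurent_apply A B (\<Sum>j<m. Poly_Mapping.single (ext_exponent j) (C j))
      = (\<Sum>j<m. mat_powi A (ext_exponent j) ** B ** C j)" for C
    by (simp add: laurent_cmat.linear_sum[OF linear_laurent_apply] single)
  then show ?thesis
    unfolding ext_block_krylov_def blockspan_def laurent_space_def by (auto simp: image_iff) metis
qed

lemma laurent_apply_inj_on_iff_nondegenerate:
  fixes A :: "complex^'n^'n" and B :: "complex^'s^'n"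
  assumes "invertible A" and "m \<ge> 1"
  shows "inj_on (laurent_apply A B) (laurent_space m)
    \<longleftrightarrow> nondegenerate_over A B (mpoly_space (m - 1))"
proof -
  \<comment> \<open>The lowest exponent of \<open>laurent_space m\<close> is \<open>- l\<close>. Its
    \<open>m\<close> consecutive exponents end at \<open>m - 1 - l\<close> for either parity of
    \<open>m\<close>, so the shift by \<open>l\<close> moves them exactly onto
    \<open>0, ..., m - 1\<close>.\<close>
  define l where "l = (m - 1) div 2"
  have "int (m div 2) = int (m - 1) - int l"
    using assms(2) unfolding l_def by presburger
  then have laurent: "laurent_space m = {R :: 's laurent_mpoly. Poly_Mapping.keys R \<subseteq> {- int l..int (m - 1) - int l}}"
    using laurent_space_eq_keys[OF assms(2)] by (simp only: l_def)
  have mpoly: "(mpoly_space (m - 1) :: 's laurent_mpoly set) = laurent_shift (int l) ` laurent_space m"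
  proof (intro equalityI subsetI)
    fix R :: "'s laurent_mpoly" assume "R \<in> mpoly_space (m - 1)"
    then have "laurent_shift (- int l) R \<in> laurent_space m"
      by (fastforce simp: laurent mpoly_space_eq_keys keys_laurent_shift)
    then show "R \<in> laurent_shift (int l) ` laurent_space m"
      by (rule rev_image_eqI) (simp add: laurent_shift_add)
  qed (fastforce simp: laurent mpoly_space_eq_keys keys_laurent_shift)
  have "inj_on (laurent_apply A B) (laurent_space m)
      \<longleftrightarrow> (\<forall>R\<in>laurent_space m. laurent_apply A B R = 0 \<longrightarrow> R = 0)"
    by (rule laurent_cmat.linear_inj_on_iff_eq_0[OF linear_laurent_apply subspace_laurent_space])
  \<comment> \<open>Every polynomial \<open>P\<close> is a shift of some \<open>R\<close> in the
    Laurent space, and both \<open>P = 0\<close> and the vanishing of its value are equivalent to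
    the same conditions on \<open>R\<close>.\<close>
  also have "\<dots> \<longleftrightarrow> nondegenerate_over A B (mpoly_space (m - 1))"
    unfolding nondegenerate_over_def laurent_inner_def conj_transpose_mult_self_eq_0_iff mpoly
    by (auto simp: laurent_apply_shift_eq_0_iff[OF assms(1)])
  finally show ?thesis .
qed

theorem theorem3p5:
  fixes A :: "complex^'n^'n" and B :: "complex^'s^'n" and m :: nat
  assumes "invertible A" and "m \<ge> 1"
  shows "(cmat.dim (ext_block_krylov A B m) = CARD('s)^2 * m
            \<longleftrightarrow> nondegenerate_over A B (mpoly_space (m - 1)))
       \<and> (cmat.dim (ext_block_krylov A B m) = CARD('s)^2 * m
            \<longrightarrow> linear_iso_on (laurent_space m) (ext_block_krylov A B m) (laurent_apply A B)
              \<and> isometric_on (laurent_inner A B) (laurent_space m) (laurent_apply A B))"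
proof -
  let ?K = "{- int ((m - 1) div 2)..int (m div 2)}"
  \<comment> \<open>Counting through the bijection with \<open>{..<m}\<close> avoids a parity split
    of the interval length.\<close>
  have "card ?K = m"
    using bij_betw_same_card[OF bij_betw_ext_exponent[of m]] assms(2) by simp
  then have dim: "cmat.dim (ext_block_krylov A B m) = CARD('s)^2 * m
      \<longleftrightarrow> inj_on (laurent_apply A B) (laurent_space m)"
    using dim_image_laurent_apply_iff[of ?K A B]
    by (simp only: ext_block_krylov_eq_image laurent_space_eq_keys[OF assms(2)] finite_atLeastAtMost_int
        simp_thms)
  have "linear_iso_on (laurent_space m) (ext_block_krylov A B m) (laurent_apply A B)"
    if "inj_on (laurent_apply A B) (laurent_space m)"
    using that linear_laurent_apply[of A B]
    by (auto simp: linear_iso_on_def bij_betw_def ext_block_krylov_eq_image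
        laurent_cmat.linear_add laurent_cmat.linear_scale)
  \<comment> \<open>The form on Laurent polynomials is by definition the Euclidean one of the
    values, so this holds without injectivity.\<close>
  moreover have "isometric_on (laurent_inner A B) (laurent_space m) (laurent_apply A B)"
    by (simp add: isometric_on_def laurent_inner_def mat_inner_def)
  ultimately show ?thesis
    using dim laurent_apply_inj_on_iff_nondegenerate[OF assms] by blast
qed

end
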